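(* There are a set of formulas $\Gamma$ and a formula $A$ of $\mathscr{L}$ such that $\Gamma\models^{SH}_\Delta A$ and $\Gamma\not\vdash_{\texttt{IL}} A$.
   Context: The meta-language reasoning is classical; $\vdash_{\texttt{IL}}$ is derivability in intuitionistic propositional logic. Language $\mathscr{L}$: formulas $X ::= p \mid \bot \mid X\wedge X \mid X \vee X \mid X \rightarrow X$ ($p$ propositional atoms; the $p$'s and $\bot$ are atoms); $\neg A := A\rightarrow\bot$. An atomic base $\mathfrak{B}$ is a countable set of production rules with atomic premises $A_1,\dots,A_n$ ($n\ge0$, $A_i\neq\bot$) and atomic conclusion; $\texttt{DER}_{\mathfrak{B}}$ is the set of its derivations, and bases are required to be consistent ($\bot$ is not derivable). An argument structure is a pair $\langle T,f\rangle$ where $T$ is a finite tree whose nodes are formulas of $\mathscr{L}$ or empty (empty nodes only as top-nodes), and $f$ is a function defined on a subset of the non-empty top-nodes assigning to each such node a node below it (discharge). Top-nodes are assumptions, the root is the conclusion; the structure is closed if all assumptions are discharged, else open; it is "from $\Gamma$ to $A$" if $\Gamma$ is its set of undischarged assumptions and $A$ its conclusion. For $\mathscr{D}$ from $\Gamma$ to $A$ and $\sigma$ assigning to each $B\in\Gamma$ a closed argument structure with conclusion $B$, $\mathscr{D}^\sigma$ is obtained by replacing each $B\in\Gamma$ by $\sigma(B)$. The introduction rules are: from $A$ and $B$ infer $A\wedge B$; from $A_i$ infer $A_1\vee A_2$ ($i=1,2$); from $B$ infer $A\rightarrow B$ discharging $A$; an argument structure is canonical iff its last step is an instance of an introduction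 rule. A reduction is a pair $\langle\mathscr{D}^1,\mathscr{D}^2\rangle$ of argument structures where $\mathscr{D}^2$ has the same conclusion as, and at most the same assumptions as, $\mathscr{D}^1$. An r-system is a set of reductions. An r-sequence $\langle\mathscr{D}^1_1,\mathscr{D}^2_1\rangle,\dots,\langle\mathscr{D}^1_n,\mathscr{D}^2_n\rangle$ with $\mathscr{D}^2_{i-1}=\mathscr{D}^1_i$ for each $i$ is from $\mathscr{D}^1_1$ to $\mathscr{D}^2_n$. For an r-system $\Sigma$, $\mathscr{D}\le^\Sigma\mathscr{D}^*$ iff $\Sigma$ contains an r-sequence from $\mathscr{D}$ to $\mathscr{D}^*$. An argument is a pair $\langle\mathscr{D},\Sigma\rangle$. It is SH-valid on $\mathfrak{B}$ iff: (i) if $\mathscr{D}$ is closed with atomic conclusion, then $\mathscr{D}\le^{\Sigma}\langle T,\emptyset\rangle$ for some closed $T\in\texttt{DER}_{\mathfrak{B}}$; (ii) if $\mathscr{D}$ is closed with non-atomic conclusion, then $\mathscr{D}\le^{\Sigma}\mathscr{D}^*$ for some closed canonical $\mathscr{D}^*$ whose immediate sub-structures, paired with $\Sigma$, are SH-valid on $\mathfrak{B}$; (iii) if $\mathscr{D}$ is open from $\Gamma$ to $A$, then for every $\sigma$ and every r-system $\Sigma^+\supseteq\Sigma$, if $\langle\sigma(B),\Sigma^+\rangle$ is SH-valid on $\mathfrak{B}$ for the $B\in\Gamma$, then $\langle\mathscr{D}^\sigma,\Sigma^+\rangle$ is SH-valid on $\mathfrak{B}$. Finally, $\Gamma\models^{SH}_\Delta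 A$ iff there is an argument $\langle\mathscr{D},\Sigma\rangle$ from $\Gamma$ to $A$ that is SH-valid on every base $\mathfrak{B}$. *)

theory Defs
  imports Main "HOL-Library.Countable_Set" "HOL-Library.Sublist"
begin

datatype form =
    Atm nat
  | Bot
  | Conj form form
  | Disj form form
  | Impl form form

abbreviation Neg :: "form \<Rightarrow> form" where
  "Neg A \<equiv> Impl A Bot"

fun atomic :: "form \<Rightarrow> bool" where
  "atomic (Atm p) = True"
| "atomic Bot = True"
| "atomic _ = False"

inductive il_derives :: "form set \<Rightarrow> form \<Rightarrow> bool" where
  assm: "A \<in> \<Gamma> \<Longrightarrow> il_derives \<Gamma> A"
| botE: "il_derives \<Gamma> Bot \<Longrightarrow> il_derives \<Gamma> A"
| conjI: "il_derives \<Gamma> A \<Longrightarrow> il_derives \<Gamma> B \<Longrightarrow> il_derives \<Gamma> (Conj A B)"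
| conjE1: "il_derives \<Gamma> (Conj A B) \<Longrightarrow> il_derives \<Gamma> A"
| conjE2: "il_derives \<Gamma> (Conj A B) \<Longrightarrow> il_derives \<Gamma> B"
| disjI1: "il_derives \<Gamma> A \<Longrightarrow> il_derives \<Gamma> (Disj A B)"
| disjI2: "il_derives \<Gamma> B \<Longrightarrow> il_derives \<Gamma> (Disj A B)"
| disjE: "il_derives \<Gamma> (Disj A B) \<Longrightarrow> il_derives (insert A \<Gamma>) C \<Longrightarrow>
    il_derives (insert B \<Gamma>) C \<Longrightarrow> il_derives \<Gamma> C"
| implI: "il_derives (insert A \<Gamma>) B \<Longrightarrow> il_derives \<Gamma> (Impl A B)"
| implE: "il_derives \<Gamma> (Impl A B) \<Longrightarrow> il_derives \<Gamma> A \<Longrightarrow> il_derives \<Gamma> B"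

text \<open>
  A node without children is an assumption; a step without premises is a node whose only
  child is \<open>Empty\<close>. A node is addressed by the path of child indices leading to it from the
  root, so that a node lies below another one iff its address is a strict prefix.
\<close>

datatype tree = Empty | Node form "tree list"

type_synonym pos = "nat list"

fun subtree_at :: "tree \<Rightarrow> pos \<Rightarrow> tree option" where
  "subtree_at t [] = Some t"
| "subtree_at Empty (i # p) = None"
| "subtree_at (Node A ts) (i # p) = (if i < length ts then subtree_at (ts ! i) p else None)"

fun root_formula :: "tree \<Rightarrow> form option" where
  "root_formula Empty = None"
| "root_formula (Node A ts) = Some A"

type_synonym arg_struct = "tree \<times> (pos \<Rightarrow> pos option)"

definition top_formula :: "tree \<Rightarrow> pos \<Rightarrow> form \<Rightarrow> bool" where
  "top_formula T p A \<longleftrightarrow> subtree_at T p = Some (Node A [])"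

text \<open>The root of an argument structure is its conclusion, hence not the empty node.\<close>

definition argument_structure :: "arg_struct \<Rightarrow> bool" where
  "argument_structure D \<longleftrightarrow> fst D \<noteq> Empty \<and>
     (\<forall>p q. snd D p = Some q \<longrightarrow> (\<exists>A. top_formula (fst D) p A) \<and> strict_prefix q p)"

definition undischarged :: "arg_struct \<Rightarrow> pos \<Rightarrow> form \<Rightarrow> bool" where
  "undischarged D p A \<longleftrightarrow> top_formula (fst D) p A \<and> snd D p = None"

definition assumptions :: "arg_struct \<Rightarrow> form set" where
  "assumptions D = {A. \<exists>p. undischarged D p A}"

definition conclusion :: "arg_struct \<Rightarrow> form" where
  "conclusion D = the (root_formula (fst D))"

definition closed_struct :: "arg_struct \<Rightarrow> bool" where
  "closed_struct D \<longleftrightarrow> assumptions D = {}"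

definition from_to :: "arg_struct \<Rightarrow> form set \<Rightarrow> form \<Rightarrow> bool" where
  "from_to D \<Gamma> A \<longleftrightarrow> assumptions D = \<Gamma> \<and> conclusion D = A"

type_synonym rule = "form list \<times> form"

definition production_rule :: "rule \<Rightarrow> bool" where
  "production_rule r \<longleftrightarrow> (\<forall>A\<in>set (fst r). atomic A \<and> A \<noteq> Bot) \<and> atomic (snd r)"

inductive_set DER :: "rule set \<Rightarrow> tree set" for \<BB> :: "rule set" where
  assumption: "atomic A \<Longrightarrow> Node A [] \<in> DER \<BB>"
| axiom: "([], C) \<in> \<BB> \<Longrightarrow> Node C [Empty] \<in> DER \<BB>"
| rule: "(As, C) \<in> \<BB> \<Longrightarrow> As \<noteq> [] \<Longrightarrow> map root_formula ts = map Some As \<Longrightarrow>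
    (\<forall>t\<in>set ts. t \<in> DER \<BB>) \<Longrightarrow> Node C ts \<in> DER \<BB>"

definition closed_DER :: "rule set \<Rightarrow> tree set" where
  "closed_DER \<BB> = {T \<in> DER \<BB>. closed_struct (T, Map.empty)}"

definition atomic_base :: "rule set \<Rightarrow> bool" where
  "atomic_base \<BB> \<longleftrightarrow> countable \<BB> \<and> (\<forall>r\<in>\<BB>. production_rule r) \<and>
     \<not> (\<exists>T\<in>closed_DER \<BB>. root_formula T = Some Bot)"

text \<open>
  \<open>graft s f T\<close> replaces the top-formulas \<open>B\<close> of \<open>T\<close> on which \<open>f\<close> is undefined by \<open>s B\<close>.
  In \<open>subst_struct D \<sigma>\<close>, the grafted copy of \<open>\<sigma> B\<close> at address \<open>q\<close> keeps the discharges of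
  \<open>\<sigma> B\<close>, relocated to \<open>q\<close>; the discharges of \<open>D\<close> are unchanged.
\<close>

function graft :: "(form \<Rightarrow> tree) \<Rightarrow> (pos \<Rightarrow> pos option) \<Rightarrow> tree \<Rightarrow> tree" where
  "graft s f Empty = Empty"
| "graft s f (Node A ts) =
     (if ts = [] \<and> f [] = None then s A
      else Node A (map (\<lambda>i. graft s (\<lambda>p. f (i # p)) (ts ! i)) [0..<length ts]))"
  by pat_completeness auto
termination
  by (relation "measure (\<lambda>(s, f, T). size T)")
     (auto simp: less_Suc_eq_le intro!: size_list_estimation' [OF nth_mem])

definition subst_struct :: "arg_struct \<Rightarrow> (form \<Rightarrow> arg_struct) \<Rightarrow> arg_struct" where
  "subst_struct D \<sigma> =
     (graft (\<lambda>B. fst (\<sigma> B)) (snd D) (fst D),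
      \<lambda>p. if \<exists>q B. undischarged D q B \<and> prefix q p
          then let (q, B) = (THE (q, B). undischarged D q B \<and> prefix q p)
               in map_option (\<lambda>x. q @ x) (snd (\<sigma> B) (drop (length q) p))
          else snd D p)"

text \<open>
  Assumptions discharged at the root become undischarged in the immediate sub-structures.
\<close>

definition sub_struct :: "arg_struct \<Rightarrow> nat \<Rightarrow> tree \<Rightarrow> arg_struct" where
  "sub_struct D i t =
     (t, \<lambda>p. case snd D (i # p) of Some (j # q) \<Rightarrow> Some q | _ \<Rightarrow> None)"

fun immediate_subs :: "arg_struct \<Rightarrow> arg_struct set" where
  "immediate_subs (Empty, f) = {}"
| "immediate_subs (Node A ts, f) =
     {sub_struct (Node A ts, f) i (ts ! i) | i. i < length ts \<and> ts ! i \<noteq> Empty}"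

text \<open>
  The step introducing a conjunction or a disjunction discharges nothing; the step
  introducing an implication discharges occurrences of the antecedent only (possibly none).
\<close>

definition canonical :: "arg_struct \<Rightarrow> bool" where
  "canonical D \<longleftrightarrow>
     (\<exists>A B t u. fst D = Node (Conj A B) [t, u] \<and>
        root_formula t = Some A \<and> root_formula u = Some B \<and> (\<forall>p. snd D p \<noteq> Some [])) \<or>
     (\<exists>A B t. fst D = Node (Disj A B) [t] \<and>
        (root_formula t = Some A \<or> root_formula t = Some B) \<and> (\<forall>p. snd D p \<noteq> Some [])) \<or>
     (\<exists>A B t. fst D = Node (Impl A B) [t] \<and> root_formula t = Some B \<and>
        (\<forall>p. snd D p = Some [] \<longrightarrow> top_formula (fst D) p A))"

type_synonym reduct = "arg_struct \<times> arg_struct"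

definition reduction :: "reduct \<Rightarrow> bool" where
  "reduction r \<longleftrightarrow> argument_structure (fst r) \<and> argument_structure (snd r) \<and>
     conclusion (snd r) = conclusion (fst r) \<and> assumptions (snd r) \<subseteq> assumptions (fst r)"

definition r_system :: "reduct set \<Rightarrow> bool" where
  "r_system \<Sigma> \<longleftrightarrow> (\<forall>r\<in>\<Sigma>. reduction r)"

text \<open>
  An r-sequence has at least one member. Since every pair of identical argument structures is
  a reduction, admitting empty r-sequences as well would yield the same consequence relation.
\<close>

definition r_sequence :: "reduct list \<Rightarrow> bool" where
  "r_sequence rs \<longleftrightarrow> rs \<noteq> [] \<and> (\<forall>r\<in>set rs. reduction r) \<and>
     (\<forall>i. Suc i < length rs \<longrightarrow> snd (rs ! i) = fst (rs ! Suc i))"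

definition reduces :: "reduct set \<Rightarrow> arg_struct \<Rightarrow> arg_struct \<Rightarrow> bool" where
  "reduces \<Sigma> D D' \<longleftrightarrow>
     (\<exists>rs. r_sequence rs \<and> set rs \<subseteq> \<Sigma> \<and> fst (hd rs) = D \<and> snd (last rs) = D')"

definition assignment :: "form set \<Rightarrow> (form \<Rightarrow> arg_struct) \<Rightarrow> bool" where
  "assignment \<Gamma> \<sigma> \<longleftrightarrow>
     (\<forall>B\<in>\<Gamma>. argument_structure (\<sigma> B) \<and> closed_struct (\<sigma> B) \<and> conclusion (\<sigma> B) = B)"

declare conj_cong [fundef_cong]

lemma finite_assumptions: "finite (assumptions D)"
proof -
  have fin: "finite {t. \<exists>p. subtree_at T p = Some t}" for T
  proof (induction T)
    case Empty
    have "{t. \<exists>p. subtree_at Empty p = Some t} \<subseteq> {Empty}"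
    proof clarify
      fix t p assume "subtree_at Empty p = Some t"
      then show "t = Empty" by (cases p) auto
    qed
    then show ?case by (rule finite_subset) simp
  next
    case (Node A ts)
    have "{t. \<exists>p. subtree_at (Node A ts) p = Some t} \<subseteq>
        insert (Node A ts) (\<Union>u\<in>set ts. {t. \<exists>p. subtree_at u p = Some t})"
    proof clarify
      fix t p
      assume "subtree_at (Node A ts) p = Some t"
        and "t \<notin> (\<Union>u\<in>set ts. {t. \<exists>p. subtree_at u p = Some t})"
      then show "t = Node A ts"
        by (cases p) (auto split: if_splits dest: nth_mem)
    qed
    then show ?case by (rule finite_subset) (use Node in auto)
  qed
  have "(\<lambda>A. Node A []) ` assumptions D \<subseteq> {t. \<exists>p. subtree_at (fst D) p = Some t}"
    by (auto simp: assumptions_def undischarged_def top_formula_def)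
  then have "finite ((\<lambda>A. Node A []) ` assumptions D)"
    using fin by (rule finite_subset)
  then show ?thesis
    by (rule finite_imageD) (simp add: inj_on_def)
qed

lemma top_formula_prefix_eq:
  assumes "top_formula T q B" and "top_formula T p A" and "prefix q p"
  shows "q = p"
  using assms
proof (induction T p arbitrary: q rule: subtree_at.induct)
  case (1 t)
  then show ?case by simp
next
  case (2 i p)
  then show ?case by (simp add: top_formula_def)
next
  case (3 C ts i p)
  then show ?case
    by (cases q) (auto simp: top_formula_def split: if_splits)
qed

lemma top_formula_prefixes_eq:
  assumes "top_formula T q B" and "top_formula T q' B'" and "prefix q p" and "prefix q' p"
  shows "q = q' \<and> B = B'"
proof -
  have "prefix q q' \<or> prefix q' q"
    using assms(3,4) prefix_same_cases by blast
  then have "q = q'"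
    using top_formula_prefix_eq assms(1,2) by metis
  then show ?thesis
    using assms(1,2) by (simp add: top_formula_def)
qed

lemma subst_struct_discharge_inside:
  assumes "undischarged D q B"
  shows "snd (subst_struct D \<sigma>) (q @ r) = map_option (\<lambda>x. q @ x) (snd (\<sigma> B) r)"
proof -
  have "(THE (q', B'). undischarged D q' B' \<and> prefix q' (q @ r)) = (q, B)"
    by (rule the_equality)
      (use assms top_formula_prefixes_eq in \<open>auto simp: undischarged_def\<close>)
  moreover have "\<exists>q' B'. undischarged D q' B' \<and> prefix q' (q @ r)"
    using assms by auto
  ultimately show ?thesis
    by (simp add: subst_struct_def)
qed

lemma subst_struct_discharge_outside:
  assumes "\<And>q B. undischarged D q B \<Longrightarrow> \<not> prefix q p"
  shows "snd (subst_struct D \<sigma>) p = snd D p"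
  using assms by (auto simp: subst_struct_def)

lemma top_formula_graft:
  assumes "top_formula (graft s f T) p A"
  shows "(\<exists>q r B. p = q @ r \<and> top_formula T q B \<and> f q = None \<and> top_formula (s B) r A) \<or>
    (top_formula T p A \<and> f p \<noteq> None)"
  using assms
proof (induction s f T arbitrary: p rule: graft.induct)
  case (1 s f)
  then show ?case by (cases p) (auto simp: top_formula_def)
next
  case (2 s f C ts)
  show ?case
  proof (cases "ts = [] \<and> f [] = None")
    case True
    then have "p = [] @ p" "top_formula (Node C ts) [] C" "f [] = None" "top_formula (s C) p A"
      using 2(2) by (auto simp: top_formula_def)
    then show ?thesis by blast
  next
    case False
    show ?thesis
    proof (cases p)
      case Nil
      then show ?thesis using 2(2) False by (auto simp: top_formula_def)
    next
      case (Cons i p')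
      then have i: "i < length ts"
        and top: "top_formula (graft s (\<lambda>p. f (i # p)) (ts ! i)) p' A"
        using 2(2) False by (auto simp: top_formula_def split: if_splits)
      have "(\<exists>q r B. p' = q @ r \<and> top_formula (ts ! i) q B \<and> f (i # q) = None \<and>
          top_formula (s B) r A) \<or> (top_formula (ts ! i) p' A \<and> f (i # p') \<noteq> None)"
        using 2(1)[OF False _ top] i by simp
      moreover have "top_formula (Node C ts) (i # q) B = top_formula (ts ! i) q B" for q B
        using i by (simp add: top_formula_def)
      ultimately show ?thesis
        unfolding Cons by (metis append_Cons)
    qed
  qed
qed

lemma top_formula_graft_inside:
  assumes "top_formula T q B" and "f q = None" and "top_formula (s B) r A"
  shows "top_formula (graft s f T) (q @ r) A"
  using assms
proof (induction s f T arbitrary: q rule: graft.induct)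
  case (1 s f)
  then show ?case by (cases q) (auto simp: top_formula_def)
next
  case (2 s f C ts)
  then show ?case by (cases q) (auto simp: top_formula_def split: if_splits)
qed

lemma top_formula_graft_outside:
  assumes "top_formula T p A" and "f p \<noteq> None"
  shows "top_formula (graft s f T) p A"
  using assms
proof (induction s f T arbitrary: p rule: graft.induct)
  case (1 s f)
  then show ?case by (cases p) (auto simp: top_formula_def)
next
  case (2 s f C ts)
  then show ?case by (cases p) (auto simp: top_formula_def split: if_splits)
qed

lemma closed_subst_struct:
  assumes "assignment (assumptions D) \<sigma>"
  shows "closed_struct (subst_struct D \<sigma>)"
proof -
  have "\<not> undischarged (subst_struct D \<sigma>) p A" for p A
  proof
    assume und: "undischarged (subst_struct D \<sigma>) p A"
    then have top: "top_formula (graft (\<lambda>B. fst (\<sigma> B)) (snd D) (fst D)) p A"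
      by (simp add: undischarged_def subst_struct_def)
    consider
        (inside) q r B where "p = q @ r" "undischarged D q B" "top_formula (fst (\<sigma> B)) r A"
      | (outside) "top_formula (fst D) p A" "snd D p \<noteq> None"
      using top_formula_graft[OF top] unfolding undischarged_def by blast
    then show False
    proof cases
      case inside
      have "closed_struct (\<sigma> B)"
        using assms inside(2) by (auto simp: assignment_def assumptions_def)
      then have "snd (\<sigma> B) r \<noteq> None"
        using inside(3) by (auto simp: closed_struct_def assumptions_def undischarged_def)
      then show False
        using und subst_struct_discharge_inside[OF inside(2)] inside(1)
        by (auto simp: undischarged_def)
    next
      case outside
      have "snd (subst_struct D \<sigma>) p = snd D p"
      proof (rule subst_struct_discharge_outside)
        fix q B assume "undischarged D q B"
        then show "\<not> prefix q p"
          using outside top_formula_prefix_eq[of "fst D" q B p A] by (auto simp: undischarged_def)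
      qed
      then show False
        using und outside(2) by (simp add: undischarged_def)
    qed
  qed
  then show ?thesis
    by (simp add: closed_struct_def assumptions_def)
qed

lemma conclusion_subst_struct:
  assumes "assignment (assumptions D) \<sigma>"
  shows "conclusion (subst_struct D \<sigma>) = conclusion D"
proof (cases "fst D")
  case Empty
  then show ?thesis by (simp add: conclusion_def subst_struct_def)
next
  case (Node A ts)
  show ?thesis
  proof (cases "ts = [] \<and> snd D [] = None")
    case True
    then have "A \<in> assumptions D"
      using Node by (auto simp: assumptions_def undischarged_def top_formula_def intro!: exI[of _ "[]"])
    then have "conclusion (\<sigma> A) = A"
      using assms by (auto simp: assignment_def)
    then show ?thesis
      using True Node by (auto simp: conclusion_def subst_struct_def)
  next
    case False
    then show ?thesis
      using Node by (auto simp: conclusion_def subst_struct_def)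
  qed
qed

lemma argument_structure_subst_struct:
  assumes D: "argument_structure D" and \<sigma>: "assignment (assumptions D) \<sigma>"
  shows "argument_structure (subst_struct D \<sigma>)"
proof -
  have str: "argument_structure (\<sigma> B)" if "undischarged D q B" for q B
    using \<sigma> that by (auto simp: assignment_def assumptions_def)
  have "fst (subst_struct D \<sigma>) \<noteq> Empty"
  proof (cases "fst D")
    case Empty
    then show ?thesis using D by (simp add: argument_structure_def)
  next
    case (Node A ts)
    then show ?thesis
      using str[of "[]" A]
      by (auto simp: subst_struct_def argument_structure_def undischarged_def top_formula_def)
  qed
  moreover have "(\<exists>A. top_formula (fst (subst_struct D \<sigma>)) p A) \<and> strict_prefix x p"
    if x: "snd (subst_struct D \<sigma>) p = Some x" for p x
  proof (cases "\<exists>q B. undischarged D q B \<and> prefix q p")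
    case True
    then obtain q B r where q: "undischarged D q B" and p: "p = q @ r"
      by (auto simp: prefix_def)
    then obtain y where "snd (\<sigma> B) r = Some y" and y: "x = q @ y"
      using x subst_struct_discharge_inside[OF q] by auto
    then obtain A where top: "top_formula (fst (\<sigma> B)) r A" and "strict_prefix y r"
      using str[OF q] by (auto simp: argument_structure_def)
    then have "strict_prefix x p"
      using p y by (auto simp: strict_prefix_def)
    moreover have "top_formula (fst (subst_struct D \<sigma>)) p A"
      using q top p
        top_formula_graft_inside[of "fst D" q B "snd D" "\<lambda>B. fst (\<sigma> B)" r A]
      by (simp add: undischarged_def subst_struct_def)
    ultimately show ?thesis by blast
  next
    case False
    then have dis: "snd D p = Some x"
      using x subst_struct_discharge_outside[of D p \<sigma>] by force
    then obtain A where top: "top_formula (fst D) p A" and "strict_prefix x p"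
      using D by (auto simp: argument_structure_def)
    moreover have "top_formula (fst (subst_struct D \<sigma>)) p A"
      using top_formula_graft_outside[OF top, of "snd D"] dis by (simp add: subst_struct_def)
    ultimately show ?thesis by blast
  qed
  ultimately show ?thesis
    unfolding argument_structure_def by blast
qed

lemma argument_structure_immediate_subs:
  assumes D: "argument_structure D" and E: "E \<in> immediate_subs D"
  shows "argument_structure E"
proof -
  obtain A ts f i where D_eq: "D = (Node A ts, f)" and i: "i < length ts" "ts ! i \<noteq> Empty"
    and E_eq: "E = sub_struct D i (ts ! i)"
    using E by (cases D rule: immediate_subs.cases) auto
  have "(\<exists>B. top_formula (ts ! i) p B) \<and> strict_prefix q p" if q: "snd E p = Some q" for p q
  proof -
    obtain j where "f (i # p) = Some (j # q)"
      using q by (auto simp: E_eq D_eq sub_struct_def split: option.splits list.splits)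
    then show ?thesis
      using D i by (fastforce simp: D_eq argument_structure_def top_formula_def)
  qed
  then show ?thesis
    using i by (auto simp: argument_structure_def E_eq sub_struct_def)
qed

lemma conclusion_reduces:
  assumes "reduces \<Sigma> D D'"
  shows "conclusion D' = conclusion D"
proof -
  obtain rs where rs: "r_sequence rs" "fst (hd rs) = D" "snd (last rs) = D'"
    using assms by (auto simp: reduces_def)
  have "conclusion (snd (rs ! i)) = conclusion D" if "i < length rs" for i
    using that
  proof (induction i)
    case 0
    then show ?case
      using rs by (auto simp: r_sequence_def reduction_def hd_conv_nth)
  next
    case (Suc i)
    then show ?case
      using rs(1) by (auto simp: r_sequence_def reduction_def)
  qed
  then show ?thesis
    using rs by (auto simp: r_sequence_def last_conv_nth)
qed

lemma immediate_subs_smaller: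
  assumes "closed_struct D" and "canonical D" and "E \<in> immediate_subs D"
    and "A \<in> insert (conclusion E) (assumptions E)"
  shows "size A < size (conclusion D)"
proof -
  obtain C ts f i where D: "D = (Node C ts, f)" and i: "i < length ts"
    and E: "E = sub_struct D i (ts ! i)"
    using assms(3) by (cases D rule: immediate_subs.cases) auto
  consider "A = conclusion E" | p where "undischarged E p A"
    using assms(4) by (auto simp: assumptions_def)
  then show ?thesis
  proof cases
    case 1
    then show ?thesis
      using assms(2) i
      by (auto simp: canonical_def D E sub_struct_def conclusion_def less_Suc_eq)
  next
    case 2
    then have top: "top_formula (Node C ts) (i # p) A"
      using i by (auto simp: undischarged_def E D sub_struct_def top_formula_def)
    then have "f (i # p) \<noteq> None"
      using assms(1) by (auto simp: closed_struct_def assumptions_def undischarged_def D)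
    then have dis: "f (i # p) = Some []"
      using 2 by (auto simp: undischarged_def E D sub_struct_def split: list.splits)
    then obtain X Y where "C = Impl X Y" and "top_formula (Node C ts) (i # p) X"
      using assms(2) by (auto simp: canonical_def D)
    then show ?thesis
      using top by (auto simp: top_formula_def conclusion_def D)
  qed
qed

definition rank :: "arg_struct \<Rightarrow> nat" where
  "rank D = Max (size ` insert (conclusion D) (assumptions D))"

lemma rank_less_iff: "rank D < n \<longleftrightarrow> (\<forall>A\<in>insert (conclusion D) (assumptions D). size A < n)"
  unfolding rank_def by (subst Max_less_iff) (auto simp: finite_assumptions)

lemma size_le_rank: "A \<in> insert (conclusion D) (assumptions D) \<Longrightarrow> size A \<le> rank D"
  unfolding rank_def by (rule Max_ge) (auto simp: finite_assumptions)

lemma rank_closed: "closed_struct D \<Longrightarrow> rank D = size (conclusion D)"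
  by (simp add: rank_def closed_struct_def)

function sh_valid :: "rule set \<Rightarrow> arg_struct \<Rightarrow> reduct set \<Rightarrow> bool" where
  "sh_valid \<BB> D \<Sigma> \<longleftrightarrow>
     (if closed_struct D then
        if atomic (conclusion D) then \<exists>T\<in>closed_DER \<BB>. reduces \<Sigma> D (T, Map.empty)
        else \<exists>D'. (reduces \<Sigma> D D' \<and> closed_struct D' \<and> canonical D') \<and>
               (\<forall>E\<in>immediate_subs D'. sh_valid \<BB> E \<Sigma>)
      else
        \<forall>\<sigma> \<Sigma>'. assignment (assumptions D) \<sigma> \<and> r_system \<Sigma>' \<and> \<Sigma> \<subseteq> \<Sigma>' \<longrightarrow>
          (\<forall>B\<in>assumptions D. sh_valid \<BB> (\<sigma> B) \<Sigma>') \<longrightarrow> sh_valid \<BB> (subst_struct D \<sigma>) \<Sigma>')"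
  by pat_completeness auto
termination
proof (relation "measures [\<lambda>(\<BB>, D, \<Sigma>). rank D, \<lambda>(\<BB>, D, \<Sigma>). if closed_struct D then 0 else 1]",
    goal_cases)
  case 1
  show ?case by simp
next
  case (2 \<BB> D \<Sigma> D' E)
  then have "rank E < size (conclusion D')"
    using immediate_subs_smaller by (simp add: rank_less_iff)
  then show ?case
    using 2 conclusion_reduces[of \<Sigma> D D'] by (simp add: rank_closed)
next
  case (3 \<BB> D \<Sigma> \<sigma> \<Sigma>' B)
  then have "closed_struct (\<sigma> B)" and "conclusion (\<sigma> B) = B"
    by (auto simp: assignment_def)
  then have "rank (\<sigma> B) \<le> rank D"
    using 3 size_le_rank[of B D] by (simp add: rank_closed)
  then show ?case
    using 3 \<open>closed_struct (\<sigma> B)\<close> by auto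
next
  case (4 \<BB> D \<Sigma> \<sigma> \<Sigma>')
  then have "closed_struct (subst_struct D \<sigma>)"
    and "conclusion (subst_struct D \<sigma>) = conclusion D"
    using closed_subst_struct conclusion_subst_struct by auto
  then have "rank (subst_struct D \<sigma>) \<le> rank D"
    using size_le_rank[of "conclusion D" D] by (simp add: rank_closed)
  then show ?case
    using 4 \<open>closed_struct (subst_struct D \<sigma>)\<close> by auto
qed

declare sh_valid.simps [simp del]

definition sh_consequence :: "form set \<Rightarrow> form \<Rightarrow> bool" where
  "sh_consequence \<Gamma> A \<longleftrightarrow>
     (\<exists>D \<Sigma>. argument_structure D \<and> r_system \<Sigma> \<and> from_to D \<Gamma> A \<and>
        (\<forall>\<BB>. atomic_base \<BB> \<longrightarrow> sh_valid \<BB> D \<Sigma>))"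

end

theory Submission
  imports Defs
begin

text \<open>
  An r-system may be any set of reductions, so it may be the set of all of them. Relative to
  that r-system, which has no proper extension, all closed structures with the same conclusion
  reduce to each other. Validity on a fixed base therefore depends only on the conclusion and
  behaves like classical truth, an atom being true iff it is derivable in the base. Hence
  \<open>p \<or> \<not> p\<close> is a consequence of the empty set.
\<close>

text \<open>The three-element Heyting chain 0 < 1 < 2 under the valuation sending every atom to 1.
  Then \<open>Neg (Atm p)\<close> has value 0, so excluded middle for an atom gets 1, below the
  top.\<close>

fun goedel_value :: "form \<Rightarrow> nat" where
  "goedel_value (Atm p) = 1"
| "goedel_value Bot = 0"
| "goedel_value (Conj A B) = min (goedel_value A) (goedel_value B)"
| "goedel_value (Disj A B) = max (goedel_value A) (goedel_value B)"
| "goedel_value (Impl A B) = (if goedel_value A \<le> goedel_value B then 2 else goedel_value B)"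

text \<open>The bound \<open>c\<close> stands in for the infimum of the values of the context, which
  avoids infima over arbitrary sets. It must vary in the induction because \<open>implI\<close>
  lowers it.\<close>

lemma goedel_value_sound:
  assumes "il_derives \<Gamma> A" and "c \<le> 2" and "\<forall>B\<in>\<Gamma>. c \<le> goedel_value B"
  shows "c \<le> goedel_value A"
  using assms
proof (induction arbitrary: c rule: il_derives.induct)
  case (disjE \<Gamma> A B C)
  have "c \<le> goedel_value A \<or> c \<le> goedel_value B"
    \<comment> \<open>Linearity of the chain: a bound below a maximum is below one of the
      disjuncts.\<close>
    using disjE.IH(1)[OF disjE.prems] by (simp add: le_max_iff_disj)
  then show ?case
    using disjE.IH(2,3)[of c] disjE.prems by auto
next
  case (implI A \<Gamma> B)
  then show ?case
    \<comment> \<open>Residuation: if the minimum is below the value of \<open>B\<close>, then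
      either \<open>A\<close> is below \<open>B\<close> and the implication has the top value, or
      \<open>c\<close> is below \<open>B\<close>.\<close>
    using implI.IH[of "min c (goedel_value A)"] by (auto simp: min_le_iff_disj)
next
  case (implE \<Gamma> A B)
  show ?case
    using implE.IH[OF implE.prems] by (auto split: if_splits)
qed fastforce+

lemma not_il_derives_excluded_middle: "\<not> il_derives {} (Disj (Atm p) (Neg (Atm p)))"
  using goedel_value_sound[of "{}" "Disj (Atm p) (Neg (Atm p))" 2] by auto

lemma closed_struct_empty_discharge:
  "closed_struct (T, Map.empty) \<longleftrightarrow> (\<forall>p A. \<not> top_formula T p A)"
  by (auto simp: closed_struct_def assumptions_def undischarged_def)

lemma top_formula_Empty [simp]: "\<not> top_formula Empty p A"
  by (cases p) (auto simp: top_formula_def)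

lemma top_formula_unary_node [simp]:
  "top_formula (Node C [t]) p A \<longleftrightarrow> (\<exists>q. p = 0 # q \<and> top_formula t q A)"
  by (cases p) (auto simp: top_formula_def)

lemma top_formula_leaf [simp]: "top_formula (Node C []) p A \<longleftrightarrow> p = [] \<and> A = C"
  by (cases p) (auto simp: top_formula_def)

lemma argument_structure_empty_discharge [simp]:
  "argument_structure (T, Map.empty) \<longleftrightarrow> T \<noteq> Empty"
  by (simp add: argument_structure_def)

lemma immediate_subs_unary_node:
  "t \<noteq> Empty \<Longrightarrow> immediate_subs (Node C [t], f) = {sub_struct (Node C [t], f) 0 t}"
  by auto

lemma sub_struct_empty_discharge [simp]: "sub_struct (T, Map.empty) i t = (t, Map.empty)"
  by (simp add: sub_struct_def)

text \<open>One step suffices, since a closed target makes the condition on assumptions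
  trivial.\<close>

lemma reduces_all_reductions:
  assumes "argument_structure D" "argument_structure D'"
    and "closed_struct D'" "conclusion D' = conclusion D"
  shows "reduces {r. reduction r} D D'"
  using assms unfolding reduces_def
  by (intro exI[of _ "[(D, D')]"]) (auto simp: r_sequence_def reduction_def closed_struct_def)

lemma DER_root_formula:
  assumes "T \<in> DER \<BB>"
  obtains C where "root_formula T = Some C"
  using assms by cases auto

lemma sh_valid_atomI:
  assumes "T \<in> closed_DER \<BB>" and "root_formula T = Some (Atm p)"
  shows "sh_valid \<BB> (T, Map.empty) {r. reduction r}"
proof -
  have closed: "closed_struct (T, Map.empty)" and "T \<noteq> Empty"
    using assms by (auto simp: closed_DER_def)
  \<comment> \<open>An r-sequence is nonempty, so the identity pair serves as the single
    step.\<close>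
  moreover have "reduces {r. reduction r} (T, Map.empty) (T, Map.empty)"
    using closed \<open>T \<noteq> Empty\<close> by (intro reduces_all_reductions) auto
  ultimately show ?thesis
    using assms by (subst sh_valid.simps) (auto simp: conclusion_def)
qed

lemma sh_valid_atomD:
  assumes "sh_valid \<BB> D \<Sigma>" and "closed_struct D" and "conclusion D = Atm p"
  shows "\<exists>T\<in>closed_DER \<BB>. root_formula T = Some (Atm p)"
proof -
  obtain T where T: "T \<in> closed_DER \<BB>" and red: "reduces \<Sigma> D (T, Map.empty)"
    using assms by (subst (asm) sh_valid.simps) auto
  have "the (root_formula T) = Atm p"
    using conclusion_reduces[OF red] assms(3) by (simp add: conclusion_def)
  then have "root_formula T = Some (Atm p)"
    using T by (auto simp: closed_DER_def elim: DER_root_formula)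
  with T show ?thesis ..
qed

text \<open>Vacuous: by \<open>sh_valid_atomD\<close>, no closed structure for the atom is valid
  under any r-system, so no assignment satisfies the premise of the clause for open
  structures.\<close>

lemma sh_valid_underivable_assumption:
  assumes "\<not> (\<exists>T\<in>closed_DER \<BB>. root_formula T = Some (Atm p))"
    and "Atm p \<in> assumptions D"
  shows "sh_valid \<BB> D \<Sigma>"
proof -
  have "\<not> sh_valid \<BB> (\<sigma> (Atm p)) \<Sigma>'" if "assignment (assumptions D) \<sigma>" for \<sigma> \<Sigma>'
    using that assms sh_valid_atomD[of \<BB> "\<sigma> (Atm p)" \<Sigma>' p] by (auto simp: assignment_def)
  moreover have "\<not> closed_struct D"
    using assms(2) by (auto simp: closed_struct_def)
  ultimately show ?thesis
    using assms(2) by (subst sh_valid.simps) auto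
qed

lemma sh_valid_canonicalI:
  assumes "closed_struct D" and "\<not> atomic (conclusion D)"
    and "reduces \<Sigma> D D'" and "closed_struct D'" and "canonical D'"
    and "\<forall>E\<in>immediate_subs D'. sh_valid \<BB> E \<Sigma>"
  shows "sh_valid \<BB> D \<Sigma>"
proof -
  have "\<exists>D'. (reduces \<Sigma> D D' \<and> closed_struct D' \<and> canonical D') \<and>
      (\<forall>E\<in>immediate_subs D'. sh_valid \<BB> E \<Sigma>)"
    using assms(3-6) by blast
  then show ?thesis
    by (subst sh_valid.simps) (simp only: assms(1,2) if_True if_False)
qed

text \<open>The arbitrary inference from \<open>Atm p\<close> to \<open>Bot\<close> is vacuously
  valid here; discharging its assumption gives a canonical reduct.\<close>

lemma sh_valid_negI:
  assumes "\<not> (\<exists>T\<in>closed_DER \<BB>. root_formula T = Some (Atm p))"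
  shows "sh_valid \<BB> (Node (Neg (Atm p)) [Empty], Map.empty) {r. reduction r}"
    (is "sh_valid \<BB> ?D ?\<Sigma>")
proof -
  define u where "u = Node Bot [Node (Atm p) []]"
  \<comment> \<open>The leaf at \<open>[0, 0]\<close> is discharged at the root, whose address is
    \<open>[]\<close>.\<close>
  define D' where "D' = (Node (Neg (Atm p)) [u], [[0, 0] \<mapsto> []] :: pos \<Rightarrow> pos option)"
  have closed: "closed_struct D'"
    by (auto simp: D'_def u_def closed_struct_def assumptions_def undischarged_def)
  have canon: "canonical D'"
    by (auto simp: D'_def u_def canonical_def)
  have "argument_structure D'"
    by (auto simp: D'_def u_def argument_structure_def split: if_splits)
  then have red: "reduces ?\<Sigma> ?D D'"
    using closed by (intro reduces_all_reductions) (auto simp: D'_def conclusion_def)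
  \<comment> \<open>Passing to the sub-structure drops the discharge at the root, so the leaf, now
    at \<open>[0]\<close>, is open again.\<close>
  have "Atm p \<in> assumptions (sub_struct D' 0 u)"
    by (auto simp: assumptions_def undischarged_def D'_def u_def sub_struct_def
        intro!: exI[of _ "[0]"])
  then have "sh_valid \<BB> (sub_struct D' 0 u) ?\<Sigma>"
    by (rule sh_valid_underivable_assumption[OF assms])
  then have "\<forall>E\<in>immediate_subs D'. sh_valid \<BB> E ?\<Sigma>"
    using immediate_subs_unary_node[of u] by (simp add: D'_def u_def)
  moreover have "closed_struct ?D" "\<not> atomic (conclusion ?D)"
    by (auto simp: closed_struct_empty_discharge conclusion_def)
  ultimately show ?thesis
    using red closed canon by (intro sh_valid_canonicalI)
qed

text \<open>The premiseless structure does not mention \<open>t\<close>, so one and the same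
  structure can reduce to different canonical ones on different bases.\<close>

lemma sh_valid_disjI:
  assumes "sh_valid \<BB> (t, Map.empty) {r. reduction r}" and "closed_struct (t, Map.empty)"
    and "root_formula t = Some A \<or> root_formula t = Some B"
  shows "sh_valid \<BB> (Node (Disj A B) [Empty], Map.empty) {r. reduction r}"
    (is "sh_valid \<BB> ?D ?\<Sigma>")
proof -
  let ?D' = "(Node (Disj A B) [t], Map.empty) :: arg_struct"
  have t: "t \<noteq> Empty"
    using assms(3) by auto
  have closed: "closed_struct ?D'"
    using assms(2) by (auto simp: closed_struct_empty_discharge)
  have canon: "canonical ?D'"
    using assms(3) by (auto simp: canonical_def)
  have red: "reduces ?\<Sigma> ?D ?D'"
    using closed by (intro reduces_all_reductions) (auto simp: conclusion_def)
  have "\<forall>E\<in>immediate_subs ?D'. sh_valid \<BB> E ?\<Sigma>"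
    using assms(1) immediate_subs_unary_node[OF t] by simp
  moreover have "closed_struct ?D" "\<not> atomic (conclusion ?D)"
    by (auto simp: closed_struct_empty_discharge conclusion_def)
  ultimately show ?thesis
    using red closed canon by (intro sh_valid_canonicalI)
qed

lemma sh_consequence_excluded_middle: "sh_consequence {} (Disj (Atm p) (Neg (Atm p)))"
proof -
  let ?D = "(Node (Disj (Atm p) (Neg (Atm p))) [Empty], Map.empty) :: arg_struct"
  have "sh_valid \<BB> ?D {r. reduction r}" for \<BB>
  \<comment> \<open>A classical case split: the argument is fixed in advance, and only the disjunct
    reached by reduction depends on the base.\<close>
  proof (cases "\<exists>T\<in>closed_DER \<BB>. root_formula T = Some (Atm p)")
    case True
    then obtain T where "T \<in> closed_DER \<BB>" "root_formula T = Some (Atm p)" by blast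
    then show ?thesis
      by (intro sh_valid_disjI[of _ T] sh_valid_atomI) (auto simp: closed_DER_def)
  next
    case False
    then show ?thesis
      by (intro sh_valid_disjI[OF sh_valid_negI]) (auto simp: closed_struct_empty_discharge)
  qed
  moreover have "from_to ?D {} (Disj (Atm p) (Neg (Atm p)))"
    by (auto simp: from_to_def conclusion_def assumptions_def undischarged_def)
  moreover have "argument_structure ?D" "r_system {r. reduction r}"
    by (auto simp: r_system_def)
  ultimately show ?thesis
    unfolding sh_consequence_def by blast
qed

theorem theorem3:
  shows "\<exists>(\<Gamma> :: form set) (A :: form). sh_consequence \<Gamma> A \<and> \<not> il_derives \<Gamma> A"
  using sh_consequence_excluded_middle not_il_derives_excluded_middle by blast

end
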